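(* Let $(X,\mathcal I)$ be an ideal $G$-space, let $n\ge 1$, and let $X=A_1\cup\dots\cup A_n$ be a partition of $X$. Then either $\mathrm{cov}(\Delta_{\mathcal I}(A_i))\le n$ for all $i\in\{1,\dots,n\}$, or else $\mathrm{cov}(\Delta_{\mathcal I}(A_i)\cdot\Delta_{\mathcal I}(A_i))<n$ for some $i\in\{1,\dots,n\}$.
   Context: A $G$-space is a set $X$ endowed with an action $G\times X\to X$, $(g,x)\mapsto gx$, of a group $G$. A Boolean ideal on a set $X$ is a nonempty proper subfamily $\mathcal I$ of the power set of $X$ such that for any $A,B\in\mathcal I$ every subset $C\subset A\cup B$ belongs to $\mathcal I$. It is $G$-invariant if $gA\in\mathcal I$ for all $g\in G$, $A\in\mathcal I$. An ideal $G$-space is a pair $(X,\mathcal I)$ of a $G$-space $X$ and a $G$-invariant Boolean ideal $\mathcal I$ on $X$. For $A\subset X$ put $\Delta_{\mathcal I}(A)=\{g\in G: gA\cap A\notin\mathcal I\}$. For $S,T\subset G$, $S\cdot T=\{st:s\in S,\ t\in T\}$. For a non-empty $A\subset G$, $\mathrm{cov}(A)=\min\{|F|:F\subset G,\ G=FA\}$; and $\mathrm{cov}(\emptyset)=\infty$, larger than any cardinal. *)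

theory Defs
  imports "HOL-Algebra.Group_Action" "HOL-Library.Disjoint_Sets"
begin

unbundle cardinal_syntax

definition boolean_ideal :: "'x set \<Rightarrow> 'x set set \<Rightarrow> bool" where
  "boolean_ideal X I \<longleftrightarrow>
     I \<subseteq> Pow X \<and> I \<noteq> {} \<and> I \<noteq> Pow X \<and>
     (\<forall>A\<in>I. \<forall>B\<in>I. \<forall>C. C \<subseteq> A \<union> B \<longrightarrow> C \<in> I)"

locale ideal_G_space = group_action G X \<phi>
  for G (structure) and X :: "'x set" and \<phi> +
  fixes I :: "'x set set"
  assumes ideal: "boolean_ideal X I"
    and invariant: "\<lbrakk>g \<in> carrier G; A \<in> I\<rbrakk> \<Longrightarrow> \<phi> g ` A \<in> I"

definition Delta ::
  "('g, 'm) monoid_scheme \<Rightarrow> ('g \<Rightarrow> 'x \<Rightarrow> 'x) \<Rightarrow> 'x set set \<Rightarrow> 'x set \<Rightarrow> 'g set" where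
  "Delta G \<phi> I A = {g \<in> carrier G. \<phi> g ` A \<inter> A \<notin> I}"

definition covers :: "('g, 'm) monoid_scheme \<Rightarrow> 'g set \<Rightarrow> 'g set set" where
  "covers G A = {F. F \<subseteq> carrier G \<and> carrier G = F <#>\<^bsub>G\<^esub> A}"

text \<open>
  Covering numbers are cardinals, represented by cardinal orders, extended by a
  top element \<open>None\<close> that serves as the covering number of the empty set.
  For nonempty \<open>A\<close>, \<open>cov G A\<close> is the cardinal of a set of least cardinality
  in \<open>covers G A\<close>; such a set exists by \<open>least_cover\<close> below, and the
  cardinal does not depend on its choice, up to the isomorphism \<open>=o\<close>.
\<close>

definition cov :: "('g, 'm) monoid_scheme \<Rightarrow> 'g set \<Rightarrow> 'g rel option" where
  "cov G A =
     (if A = {} then None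
      else Some |SOME F. F \<in> covers G A \<and> (\<forall>F'\<in>covers G A. |F| \<le>o |F'| )| )"

definition cov_le :: "'g rel option \<Rightarrow> 'c rel \<Rightarrow> bool" where
  "cov_le c k \<longleftrightarrow> (case c of None \<Rightarrow> False | Some r \<Rightarrow> r \<le>o k)"

definition cov_less :: "'g rel option \<Rightarrow> 'c rel \<Rightarrow> bool" where
  "cov_less c k \<longleftrightarrow> (case c of None \<Rightarrow> False | Some r \<Rightarrow> r <o k)"

lemma (in group) carrier_in_covers:
  assumes "A \<subseteq> carrier G" "A \<noteq> {}"
  shows "carrier G \<in> covers G A"
proof -
  obtain a where a: "a \<in> A" "a \<in> carrier G" using assms by blast
  have "x \<in> carrier G <#> A" if x: "x \<in> carrier G" for x
  proof -
    have "x = (x \<otimes> inv a) \<otimes> a" using x a by (simp add: m_assoc)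
    moreover have "x \<otimes> inv a \<in> carrier G" using x a by simp
    ultimately show ?thesis using a(1) unfolding set_mult_def by blast
  qed
  moreover have "carrier G <#> A \<subseteq> carrier G"
    using assms(1) by (intro set_mult_closed) auto
  ultimately show ?thesis unfolding covers_def by blast
qed

lemma (in group) least_cover:
  assumes "A \<subseteq> carrier G" "A \<noteq> {}"
  shows "\<exists>F. F \<in> covers G A \<and> (\<forall>F'\<in>covers G A. |F| \<le>o |F'| )"
proof -
  have "card_of ` covers G A \<noteq> {}" using carrier_in_covers[OF assms] by blast
  moreover have "\<forall>r\<in>card_of ` covers G A. Card_order r" by (simp add: card_of_Card_order)
  ultimately obtain r where "r \<in> card_of ` covers G A" "\<forall>r'\<in>card_of ` covers G A. r \<le>o r'"
    using exists_minim_Card_order by meson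
  then show ?thesis by blast
qed

lemma card_of_le_nat_iff: "|F| \<le>o |{1..n::nat}| \<longleftrightarrow> finite F \<and> card F \<le> n"
proof (cases "finite F")
  case True
  then show ?thesis
    using inj_on_iff_card_le[of F "{1..n}"] by (simp flip: card_of_ordLeq)
next
  case False
  then show ?thesis using card_of_ordLeq_finite[of F "{1..n}"] by auto
qed

lemma card_of_less_nat_iff: "|F| <o |{1..n::nat}| \<longleftrightarrow> finite F \<and> card F < n"
proof (cases "finite F")
  case True
  then show ?thesis
    using inj_on_iff_card_le[of "{1..n}" F] by (simp flip: card_of_ordLess) linarith
next
  case False
  then show ?thesis
    using card_of_le_nat_iff[of F n] ordLess_imp_ordLeq by blast
qed

lemma (in group) cov_le_nat_iff:
  assumes "A \<subseteq> carrier G"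
  shows "cov_le (cov G A) |{1..n::nat}| \<longleftrightarrow> (\<exists>F\<in>covers G A. finite F \<and> card F \<le> n)"
proof (cases "A = {}")
  case True
  then show ?thesis by (auto simp: cov_le_def cov_def covers_def set_mult_def)
next
  case False
  define M where "M = (SOME F. F \<in> covers G A \<and> (\<forall>F'\<in>covers G A. |F| \<le>o |F'| ))"
  have M: "M \<in> covers G A" "\<And>F. F \<in> covers G A \<Longrightarrow> |M| \<le>o |F|"
    using someI_ex[OF least_cover[OF assms False]] unfolding M_def by blast+
  have cov: "cov G A = Some |M|" using False by (simp add: cov_def M_def)
  have *: "|F| \<le>o |{1..n}| \<longleftrightarrow> finite F \<and> card F \<le> n" for F :: "'a set"
    by (rule card_of_le_nat_iff)
  show ?thesis
    unfolding cov_le_def cov option.case *[symmetric]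
    using M ordLeq_transitive by blast
qed

lemma (in group) cov_less_nat_iff:
  assumes "A \<subseteq> carrier G"
  shows "cov_less (cov G A) |{1..n::nat}| \<longleftrightarrow> (\<exists>F\<in>covers G A. finite F \<and> card F < n)"
proof (cases "A = {}")
  case True
  then show ?thesis by (auto simp: cov_less_def cov_def covers_def set_mult_def)
next
  case False
  define M where "M = (SOME F. F \<in> covers G A \<and> (\<forall>F'\<in>covers G A. |F| \<le>o |F'| ))"
  have M: "M \<in> covers G A" "\<And>F. F \<in> covers G A \<Longrightarrow> |M| \<le>o |F|"
    using someI_ex[OF least_cover[OF assms False]] unfolding M_def by blast+
  have cov: "cov G A = Some |M|" using False by (simp add: cov_def M_def)
  have *: "|F| <o |{1..n}| \<longleftrightarrow> finite F \<and> card F < n" for F :: "'a set"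
    by (rule card_of_less_nat_iff)
  show ?thesis
    unfolding cov_less_def cov option.case *[symmetric]
    using M ordLeq_ordLess_trans by blast
qed

end

theory Submission
  imports Defs "HOL-Probability.Probability_Mass_Function"
begin

text \<open>
  Call a finite \<open>K \<subseteq> G\<close> consistent for \<open>A\<close> if \<open>X \<inter> (\<Inter>h\<in>K. hA)\<close> is not in the ideal, and let the weight
  of \<open>A\<close> under a finitely supported probability \<open>p\<close> on \<open>G\<close> be the supremum of \<open>p(K)\<close> over
  consistent \<open>K\<close>. For each \<open>p\<close> the weights of the cells \<open>A\<^sub>i\<close> add up to at least 1, because some
  colouring \<open>c\<close> of the support has \<open>\<Inter>h. hA\<^bsub>c(h)\<^esub>\<close> outside the ideal.

  If \<open>cov(\<Delta>(A\<^sub>j)) > n\<close>, there are \<open>n + 1\<close> points at most one of which lies in any consistent set for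
  \<open>A\<^sub>j\<close>, so some \<open>p\<close> gives \<open>A\<^sub>j\<close> weight at most \<open>1/(n+1)\<close>. Convolving \<open>p\<close> with anything on the
  left can only decrease weights. Among these \<open>p\<close> take one that nearly minimises the sum of the
  weights. Some cell \<open>A\<^sub>i\<close> then has weight \<open>w\<close> exceeding \<open>1/n\<close> by a fixed amount, and near-minimality
  yields, for each \<open>g\<close>, one consistent \<open>K\<close> nearly attaining \<open>w\<close> for both \<open>p\<close> and \<open>p * g * p\<close>.
  Hence there is \<open>t \<in> K\<close> with \<open>p {b. tgb \<in> K} > 1/n\<close>; as \<open>K\<inverse> K \<subseteq> \<Delta>(A\<^sub>i)\<close>, every translate of
  \<open>\<Delta>(A\<^sub>i)\<close> has probability above \<open>1/n\<close>. So no \<open>n\<close> translates are disjoint, which gives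
  \<open>cov(\<Delta>(A\<^sub>i) \<Delta>(A\<^sub>i)) < n\<close>. (In the limit \<open>p\<close> is a mean with \<open>p * g * p = p\<close> for all \<open>g\<close>; near-minimality
  replaces it by a finitely supported measure.)
\<close>

section \<open>Averages over finite supports, and points spread out relative to a set\<close>

lemma prob_bind_finite:
  assumes "finite (set_pmf p)" "\<And>x. finite (set_pmf (f x))"
  shows "measure_pmf.prob (bind_pmf p f) K = (\<Sum>a\<in>set_pmf p. pmf p a * measure_pmf.prob (f a) K)"
  using pmf_expectation_bind[OF assms order_refl, where h = "indicator K :: _ \<Rightarrow> real"] by simp

text \<open>The points of \<open>K\<close> cost the average \<open>d\<close> times their mass. With
  \<open>d = 0\<close> and \<open>K = {}\<close> this is the plain bound of an average.\<close>

lemma sum_pmf_le_minus_prob: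
  fixes p :: "'a pmf" and f :: "'a \<Rightarrow> real"
  assumes fin: "finite (set_pmf p)"
    and le: "\<And>a. a \<in> set_pmf p \<Longrightarrow> f a \<le> s"
    and drop: "\<And>a. a \<in> set_pmf p \<Longrightarrow> a \<in> K \<Longrightarrow> f a \<le> s - d"
  shows "(\<Sum>a\<in>set_pmf p. pmf p a * f a) \<le> s - d * measure_pmf.prob p K"
proof -
  have "(\<Sum>a\<in>set_pmf p. pmf p a * f a) \<le> (\<Sum>a\<in>set_pmf p. pmf p a * (s - d * indicator K a))"
    using le drop by (intro sum_mono mult_left_mono) (auto simp: indicator_def)
  also have "\<dots> = s * (\<Sum>a\<in>set_pmf p. pmf p a) - d * (\<Sum>a\<in>set_pmf p. indicator K a * pmf p a)"
    by (simp add: algebra_simps sum_subtractf sum_distrib_left)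
  also have "(\<Sum>a\<in>set_pmf p. pmf p a) = 1"
    by (rule sum_pmf_eq_1[OF fin order_refl])
  also have "(\<Sum>a\<in>set_pmf p. indicator K a * pmf p a) = measure_pmf.prob p K"
    using integral_measure_pmf[OF fin, where f = "indicator K :: _ \<Rightarrow> real"] 
    by (simp add: mult.commute)
  finally show ?thesis by simp
qed

text \<open>Greedy choice: fewer than \<open>m\<close> translates of \<open>D\<close> never cover
  the group, so each new point can avoid the translates by all earlier points.\<close>

lemma (in group) spread_sequence:
  assumes D: "D \<subseteq> carrier G"
    and small: "\<not> (\<exists>F\<in>covers G D. finite F \<and> card F < m)"
  shows "\<exists>h. (\<forall>j<m. h j \<in> carrier G) \<and> (\<forall>k<m. \<forall>j<k. inv (h j) \<otimes> h k \<notin> D)"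
  using small
proof (induction m)
  case 0
  then show ?case by auto
next
  case (Suc m)
  have "\<exists>h. (\<forall>j<m. h j \<in> carrier G) \<and> (\<forall>k<m. \<forall>j<k. inv (h j) \<otimes> h k \<notin> D)"
    by (rule Suc.IH) (use Suc.prems in force)
  then obtain h where h: "\<And>j. j < m \<Longrightarrow> h j \<in> carrier G"
    "\<And>k j. k < m \<Longrightarrow> j < k \<Longrightarrow> inv (h j) \<otimes> h k \<notin> D" by blast
  define F where "F = h ` {..<m}"
  have F: "F \<subseteq> carrier G" "finite F" "card F < Suc m"
    using h(1) card_image_le[of "{..<m}" h] by (auto simp: F_def)
  then have "F \<notin> covers G D" using Suc.prems by blast
  moreover have "F <#> D \<subseteq> carrier G" using F D by (intro set_mult_closed)
  ultimately obtain x where x: "x \<in> carrier G" "x \<notin> F <#> D"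
    using F(1) unfolding covers_def by blast
  have new: "inv (h j) \<otimes> x \<notin> D" if "j < m" for j
  proof
    assume "inv (h j) \<otimes> x \<in> D"
    moreover have "x = h j \<otimes> (inv (h j) \<otimes> x)" using x h(1)[OF that] by (simp flip: m_assoc)
    ultimately show False using x(2) that unfolding F_def set_mult_def by blast
  qed
  show ?case
    by (rule exI[of _ "h(m := x)"]) (use h x new in \<open>auto simp: less_Suc_eq\<close>)
qed

text \<open>Finite support leaves only finitely many colourings by the cells, which suits an ideal
  closed under finite unions.\<close>

definition finite_distr :: "('g, 'm) monoid_scheme \<Rightarrow> 'g pmf set" where
  "finite_distr G = {p. finite (set_pmf p) \<and> set_pmf p \<subseteq> carrier G}"

section \<open>Invariance of the ideal and consistent sets\<close>

context ideal_G_space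
begin

sublocale group G
  using group_hom group_hom.axioms(1) by blast

lemma ideal_subset: "B \<in> I \<Longrightarrow> C \<subseteq> B \<Longrightarrow> C \<in> I"
  using ideal unfolding boolean_ideal_def by blast

lemma ideal_Un: "B \<in> I \<Longrightarrow> C \<in> I \<Longrightarrow> B \<union> C \<in> I"
  using ideal unfolding boolean_ideal_def by blast

lemma ideal_empty: "{} \<in> I"
  using ideal unfolding boolean_ideal_def by blast

lemma carrier_not_ideal: "X \<notin> I"
  using ideal unfolding boolean_ideal_def by blast

lemma ideal_UN: "finite S \<Longrightarrow> (\<And>i. i \<in> S \<Longrightarrow> B i \<in> I) \<Longrightarrow> (\<Union>i\<in>S. B i) \<in> I"
  by (induction S rule: finite_induct) (auto intro: ideal_empty ideal_Un)

lemma image_mult: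
  assumes "B \<subseteq> X" "g \<in> carrier G" "h \<in> carrier G"
  shows "\<phi> (g \<otimes> h) ` B = \<phi> g ` \<phi> h ` B"
proof -
  have "\<phi> (g \<otimes> h) ` B = (\<lambda>x. \<phi> g (\<phi> h x)) ` B"
    using assms by (intro image_cong) (auto simp: composition_rule)
  then show ?thesis by (simp add: image_image)
qed

lemma image_inv:
  assumes "B \<subseteq> X" "g \<in> carrier G"
  shows "\<phi> (inv g) ` \<phi> g ` B = B"
proof -
  have "(\<lambda>x. \<phi> (inv g) (\<phi> g x)) ` B = (\<lambda>x. x) ` B"
    using assms by (intro image_cong) (auto intro: orbit_sym_aux)
  then show ?thesis by (simp add: image_image)
qed

lemma image_in_ideal_iff:
  assumes "B \<subseteq> X" "g \<in> carrier G"
  shows "\<phi> g ` B \<in> I \<longleftrightarrow> B \<in> I"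
  using invariant[of g B] invariant[of "inv g" "\<phi> g ` B"] image_inv[OF assms] assms by auto

text \<open>Intersecting with \<open>X\<close> gives the empty family the value \<open>X\<close>, so
  \<open>{}\<close> is consistent and suprema over consistent sets are never over an empty
  family.\<close>

definition consistent :: "'x set \<Rightarrow> 'a set \<Rightarrow> bool" where
  "consistent A K \<longleftrightarrow> finite K \<and> K \<subseteq> carrier G \<and> X \<inter> (\<Inter>h\<in>K. \<phi> h ` A) \<notin> I"

lemma consistent_empty: "consistent A {}"
  by (simp add: consistent_def carrier_not_ideal)

lemma consistent_translate:
  assumes "A \<subseteq> X" "consistent A K" "g \<in> carrier G"
  shows "consistent A ((\<otimes>) g ` K)"
proof -
  have K: "finite K" "K \<subseteq> carrier G" using assms(2) by (auto simp: consistent_def)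
  define B where "B = X \<inter> (\<Inter>h\<in>K. \<phi> h ` A)"
  have "B \<subseteq> X" "B \<notin> I" using assms(2) by (auto simp: B_def consistent_def)
  then have "\<phi> g ` B \<notin> I" using image_in_ideal_iff assms(3) by blast
  moreover have "\<phi> g ` B \<subseteq> X \<inter> (\<Inter>h\<in>(\<otimes>) g ` K. \<phi> h ` A)"
  proof -
    have "\<phi> g ` B \<subseteq> X" using \<open>B \<subseteq> X\<close> surj_prop[OF assms(3)] by blast
    moreover have "\<phi> g ` B \<subseteq> \<phi> (g \<otimes> h) ` A" if "h \<in> K" for h
      using that K assms by (subst image_mult) (auto simp: B_def)
    ultimately show ?thesis by blast
  qed
  ultimately show ?thesis using K assms(3) ideal_subset unfolding consistent_def by blast
qed

lemma Delta_inv: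
  assumes "A \<subseteq> X" "g \<in> Delta G \<phi> I A"
  shows "inv g \<in> Delta G \<phi> I A"
proof -
  have g: "g \<in> carrier G" "\<phi> g ` A \<inter> A \<notin> I" using assms by (auto simp: Delta_def)
  have "\<phi> (inv g) ` (\<phi> g ` A \<inter> A) \<subseteq> \<phi> (inv g) ` A \<inter> A"
    using image_inv[OF assms(1) g(1)] by blast
  moreover have "\<phi> (inv g) ` (\<phi> g ` A \<inter> A) \<notin> I"
    using g assms(1) by (subst image_in_ideal_iff) auto
  ultimately show ?thesis using g(1) ideal_subset unfolding Delta_def by blast
qed

text \<open>Translation by \<open>inv y\<close> carries the common part of the translates of
  \<open>A\<close> by \<open>y\<close> and \<open>z\<close> into that of \<open>A\<close> and its
  translate by \<open>inv y \<otimes> z\<close>, and it preserves being outside the ideal.\<close>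

lemma consistent_Delta:
  assumes "A \<subseteq> X" "consistent A K" "y \<in> K" "z \<in> K"
  shows "inv y \<otimes> z \<in> Delta G \<phi> I A"
proof -
  have c: "y \<in> carrier G" "z \<in> carrier G" using assms by (auto simp: consistent_def)
  define B where "B = X \<inter> (\<phi> y ` A \<inter> \<phi> z ` A)"
  have "X \<inter> (\<Inter>h\<in>K. \<phi> h ` A) \<subseteq> B" using assms(3,4) by (auto simp: B_def)
  then have "B \<notin> I" using assms(2) ideal_subset unfolding consistent_def by blast
  then have "\<phi> (inv y) ` B \<notin> I"
    using c by (subst image_in_ideal_iff) (auto simp: B_def)
  moreover have "\<phi> (inv y) ` B \<subseteq> \<phi> (inv y \<otimes> z) ` A \<inter> A"
  proof -
    have "\<phi> (inv y) ` B \<subseteq> \<phi> (inv y) ` \<phi> y ` A" by (auto simp: B_def)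
    moreover have "\<phi> (inv y) ` B \<subseteq> \<phi> (inv y) ` \<phi> z ` A" by (auto simp: B_def)
    ultimately show ?thesis
      using c assms(1) by (simp add: image_inv image_mult)
  qed
  ultimately show ?thesis using c ideal_subset unfolding Delta_def by blast
qed

section \<open>Weights of cells\<close>

definition weight :: "'x set \<Rightarrow> 'a pmf \<Rightarrow> real" where
  "weight A p = (SUP K\<in>Collect (consistent A). measure_pmf.prob p K)"

lemma weight_upper: "consistent A K \<Longrightarrow> measure_pmf.prob p K \<le> weight A p"
  unfolding weight_def by (rule cSUP_upper) (auto intro!: bdd_aboveI[of _ 1])

lemma weight_nonneg: "0 \<le> weight A p"
  using weight_upper[OF consistent_empty] by force

lemma weight_least:
  assumes "\<And>K. consistent A K \<Longrightarrow> measure_pmf.prob p K \<le> c"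
  shows "weight A p \<le> c"
  unfolding weight_def using assms consistent_empty by (intro cSUP_least) auto

text \<open>Within the support, the event lies in the translate of \<open>K\<close> by
  \<open>inv g\<close>, which is again consistent. This is why left convolution cannot raise
  weights.\<close>

lemma prob_translate_le_weight:
  assumes "A \<subseteq> X" "consistent A K" "g \<in> carrier G" "set_pmf p \<subseteq> carrier G"
  shows "measure_pmf.prob p {b. g \<otimes> b \<in> K} \<le> weight A p"
proof -
  have "measure_pmf.prob p {b. g \<otimes> b \<in> K} \<le> measure_pmf.prob p ((\<otimes>) (inv g) ` K)"
  proof (rule measure_pmf.finite_measure_mono_AE)
    show "AE x in measure_pmf p. x \<in> {b. g \<otimes> b \<in> K} \<longrightarrow> x \<in> (\<otimes>) (inv g) ` K"
    proof (rule AE_pmfI, rule impI)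
      fix x assume "x \<in> set_pmf p" "x \<in> {b. g \<otimes> b \<in> K}"
      then show "x \<in> (\<otimes>) (inv g) ` K"
        using assms(3,4) by (intro image_eqI[of _ _ "g \<otimes> x"]) (auto simp flip: m_assoc)
    qed
  qed auto
  also have "\<dots> \<le> weight A p"
    using assms by (intro weight_upper consistent_translate) auto
  finally show ?thesis .
qed

lemma sum_weight_ge_1:
  assumes cover: "X = (\<Union>i\<in>J. A i)" and J: "finite J"
    and p: "p \<in> finite_distr G"
  shows "1 \<le> (\<Sum>i\<in>J. weight (A i) p)"
proof -
  define S where "S = set_pmf p"
  have S: "finite S" "S \<subseteq> carrier G" using p by (auto simp: S_def finite_distr_def)
  define B where "B c = X \<inter> (\<Inter>h\<in>S. \<phi> h ` A (c h))" for c
  \<comment> \<open>Each \<open>h\<close> permutes \<open>X\<close>, so its translates of the cells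
    cover \<open>X\<close>; recording one such cell for every \<open>h\<close> gives a colouring.
    Since finitely many \<open>B c\<close> cover \<open>X\<close>, one is outside the ideal.\<close>
  have "X \<subseteq> (\<Union>c\<in>PiE S (\<lambda>_. J). B c)"
  proof
    fix x assume x: "x \<in> X"
    have "\<exists>i\<in>J. x \<in> \<phi> h ` A i" if "h \<in> S" for h
      using surj_prop[of h] S that x cover by blast
    then obtain c where c: "\<And>h. h \<in> S \<Longrightarrow> c h \<in> J \<and> x \<in> \<phi> h ` A (c h)" by metis
    then have "restrict c S \<in> PiE S (\<lambda>_. J)" "x \<in> B (restrict c S)"
      using x by (auto simp: B_def)
    then show "x \<in> (\<Union>c\<in>PiE S (\<lambda>_. J). B c)" by blast
  qed
  moreover have "finite (PiE S (\<lambda>_. J))" using S J by (intro finite_PiE)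
  ultimately obtain c where c: "c \<in> PiE S (\<lambda>_. J)" "B c \<notin> I"
    using ideal_UN[of "PiE S (\<lambda>_. J)" B] ideal_subset carrier_not_ideal by blast
  \<comment> \<open>The colour classes are consistent and together exhaust the support.\<close>
  define K where "K i = {h \<in> S. c h = i}" for i
  have cons: "consistent (A i) (K i)" for i
  proof -
    have "B c \<subseteq> X \<inter> (\<Inter>h\<in>K i. \<phi> h ` A i)" by (auto simp: B_def K_def)
    then have "X \<inter> (\<Inter>h\<in>K i. \<phi> h ` A i) \<notin> I" using c(2) ideal_subset by blast
    moreover have "finite (K i)" "K i \<subseteq> carrier G" using S by (auto simp: K_def)
    ultimately show ?thesis unfolding consistent_def by blast
  qed
  have "1 = measure_pmf.prob p (\<Union>i\<in>J. K i)"
  proof -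
    have "(\<Union>i\<in>J. K i) = set_pmf p" using c(1) by (auto simp: K_def S_def)
    then show ?thesis by (simp add: measure_pmf.prob_eq_1 AE_measure_pmf_iff)
  qed
  also have "\<dots> \<le> (\<Sum>i\<in>J. measure_pmf.prob p (K i))"
    using J by (intro measure_pmf.finite_measure_subadditive_finite) auto
  also have "\<dots> \<le> (\<Sum>i\<in>J. weight (A i) p)"
    by (intro sum_mono weight_upper cons)
  finally show ?thesis .
qed

lemma uncovered_Delta_light:
  assumes A: "A \<subseteq> X" and m: "m > 0"
    and small: "\<not> (\<exists>F\<in>covers G (Delta G \<phi> I A). finite F \<and> card F < m)"
  obtains p where "p \<in> finite_distr G" "weight A p \<le> 1 / real m"
proof -
  have "Delta G \<phi> I A \<subseteq> carrier G" by (auto simp: Delta_def)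
  from spread_sequence[OF this small] obtain h where
    h: "\<And>j. j < m \<Longrightarrow> h j \<in> carrier G"
       "\<And>k j. k < m \<Longrightarrow> j < k \<Longrightarrow> inv (h j) \<otimes> h k \<notin> Delta G \<phi> I A" by blast
  define p where "p = map_pmf h (pmf_of_set {..<m})"
  have ne: "{..<m} \<noteq> {}" using m by auto
  have "p \<in> finite_distr G" using h ne by (auto simp: p_def finite_distr_def)
  moreover have "weight A p \<le> 1 / real m"
  proof (rule weight_least)
    fix K assume K: "consistent A K"
    \<comment> \<open>Under \<open>p\<close> the mass of \<open>K\<close> is the number of indices
      hitting it, divided by \<open>m\<close>. Two such indices \<open>j < k\<close> would put
      \<open>inv (h j) \<otimes> h k\<close> into the Delta set.\<close>
    have "card ({..<m} \<inter> h -` K) \<le> 1"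
    proof -
      have "j = k" if "j \<in> {..<m} \<inter> h -` K" "k \<in> {..<m} \<inter> h -` K" for j k
        using that h(2)[of k j] h(2)[of j k] consistent_Delta[OF A K, of "h j" "h k"]
          consistent_Delta[OF A K, of "h k" "h j"] by (metis IntD1 IntD2 lessThan_iff linorder_neqE_nat vimageD)
      then have "card ({..<m} \<inter> h -` K) \<le> Suc 0"
        by (subst card_le_Suc0_iff_eq) blast+
      then show ?thesis by simp
    qed
    then show "measure_pmf.prob p K \<le> 1 / real m"
      using ne m by (simp add: p_def measure_pmf_of_set divide_right_mono)
  qed
  ultimately show thesis by (rule that)
qed

text \<open>Otherwise \<open>m\<close> points spread out relative to the product set give
  \<open>m\<close> disjoint translates of the Delta set, each of mass above
  \<open>1 / m\<close>.\<close>

lemma Delta_mult_covered: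
  assumes A: "A \<subseteq> X" and m: "m > 0"
    and heavy: "\<And>g. g \<in> carrier G \<Longrightarrow>
      measure_pmf.prob p {b. b \<in> carrier G \<and> g \<otimes> b \<in> Delta G \<phi> I A} > 1 / real m"
  shows "\<exists>F\<in>covers G (Delta G \<phi> I A <#> Delta G \<phi> I A). finite F \<and> card F < m"
proof (rule ccontr)
  let ?D = "Delta G \<phi> I A"
  assume small: "\<not> (\<exists>F\<in>covers G (?D <#> ?D). finite F \<and> card F < m)"
  have D: "?D \<subseteq> carrier G" by (auto simp: Delta_def)
  from spread_sequence[OF set_mult_closed[OF D D] small] obtain h where
    h: "\<And>j. j < m \<Longrightarrow> h j \<in> carrier G"
       "\<And>k j. k < m \<Longrightarrow> j < k \<Longrightarrow> inv (h j) \<otimes> h k \<notin> ?D <#> ?D" by blast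
  define T where "T j = {b. b \<in> carrier G \<and> inv (h j) \<otimes> b \<in> ?D}" for j
  have disj: "T j \<inter> T k = {}" if "j < k" "k < m" for j k
  proof (rule ccontr)
    assume "T j \<inter> T k \<noteq> {}"
    then obtain b where b: "b \<in> carrier G" "inv (h j) \<otimes> b \<in> ?D" "inv (h k) \<otimes> b \<in> ?D"
      by (auto simp: T_def)
    have c: "h j \<in> carrier G" "h k \<in> carrier G" using h(1) that by auto
    \<comment> \<open>A common point \<open>b\<close> exhibits a forbidden product, because
      \<open>?D\<close> is closed under inverses.\<close>
    have "inv (h j) \<otimes> h k = (inv (h j) \<otimes> b) \<otimes> inv (inv (h k) \<otimes> b)"
      using b c by (simp add: inv_mult_group m_assoc) (simp flip: m_assoc)
    then have "inv (h j) \<otimes> h k \<in> ?D <#> ?D"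
      using b(2) Delta_inv[OF A b(3)] unfolding set_mult_def by blast
    then show False using h(2) that by blast
  qed
  have "disjoint_family_on T {..<m}"
    unfolding disjoint_family_on_def
    by (metis disj Int_commute lessThan_iff linorder_neqE_nat)
  then have "(\<Sum>j<m. measure_pmf.prob p (T j)) = measure_pmf.prob p (\<Union>j<m. T j)"
    by (intro measure_pmf.finite_measure_finite_Union[symmetric]) auto
  also have "\<dots> \<le> 1" by simp
  finally have "(\<Sum>j<m. measure_pmf.prob p (T j)) \<le> 1" .
  moreover have "(\<Sum>j<m. measure_pmf.prob p (T j)) > (\<Sum>j<m. 1 / real m)"
    using m h(1) by (intro sum_strict_mono) (auto simp: T_def intro!: heavy)
  ultimately show False using m by simp
qed

section \<open>Smearing and heavy translates\<close>

text \<open>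
  Mixing \<open>p\<close> into \<open>p * g * p\<close> forces a single consistent set to be nearly optimal for both.
\<close>
definition smear :: "'a \<Rightarrow> 'a pmf \<Rightarrow> 'a pmf" where
  "smear g p = bind_pmf (bernoulli_pmf (1/2))
     (\<lambda>c. if c then p else bind_pmf p (\<lambda>t. map_pmf (\<lambda>b. t \<otimes> g \<otimes> b) p))"

lemma smear_finite_distr:
  "p \<in> finite_distr G \<Longrightarrow> g \<in> carrier G \<Longrightarrow> smear g p \<in> finite_distr G"
  by (auto simp: smear_def finite_distr_def subset_iff)

lemma prob_smear:
  assumes "p \<in> finite_distr G"
  shows "measure_pmf.prob (smear g p) K = measure_pmf.prob p K / 2 +
    (\<Sum>t\<in>set_pmf p. pmf p t * measure_pmf.prob p {b. t \<otimes> g \<otimes> b \<in> K}) / 2"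
proof -
  have fin: "finite (set_pmf p)" using assms by (auto simp: finite_distr_def)
  have "measure_pmf.prob (smear g p) K = measure_pmf.prob p K / 2 +
    measure_pmf.prob (bind_pmf p (\<lambda>t. map_pmf (\<lambda>b. t \<otimes> g \<otimes> b) p)) K / 2"
    unfolding smear_def using fin
    by (subst prob_bind_finite) (auto simp: UNIV_bool set_pmf_bernoulli)
  also have "measure_pmf.prob (bind_pmf p (\<lambda>t. map_pmf (\<lambda>b. t \<otimes> g \<otimes> b) p)) K =
    (\<Sum>t\<in>set_pmf p. pmf p t * measure_pmf.prob p {b. t \<otimes> g \<otimes> b \<in> K})"
    using fin by (subst prob_bind_finite) (auto simp: vimage_def)
  finally show ?thesis .
qed

lemma weight_smear_le:
  assumes A: "A \<subseteq> X" and p: "p \<in> finite_distr G" and g: "g \<in> carrier G"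
  shows "weight A (smear g p) \<le> weight A p"
proof (rule weight_least)
  fix K assume K: "consistent A K"
  have "(\<Sum>t\<in>set_pmf p. pmf p t * measure_pmf.prob p {b. t \<otimes> g \<otimes> b \<in> K})
      \<le> weight A p - 0 * measure_pmf.prob p {}"
    using p g by (intro sum_pmf_le_minus_prob prob_translate_le_weight A K)
      (auto simp: finite_distr_def)
  then show "measure_pmf.prob (smear g p) K \<le> weight A p"
    using weight_upper[OF K, of p] by (simp add: prob_smear[OF p])
qed

lemma heavy_Delta:
  assumes A: "A \<subseteq> X" and p: "p \<in> finite_distr G" and g: "g \<in> carrier G"
    and stable: "weight A p - e \<le> weight A (smear g p)"
    and d: "0 < d" "c + d \<le> weight A p"
    and e: "0 < e" "4 * e < d * (weight A p - 4 * e)"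
  shows "measure_pmf.prob p {b. b \<in> carrier G \<and> g \<otimes> b \<in> Delta G \<phi> I A} > c"
proof -
  let ?w = "weight A p" and ?P = "measure_pmf.prob p"
  let ?Z = "\<lambda>K t. ?P {b. t \<otimes> g \<otimes> b \<in> K}"
  have pG: "set_pmf p \<subseteq> carrier G" "finite (set_pmf p)" using p by (auto simp: finite_distr_def)
  \<comment> \<open>The supremum need not be attained, hence the slack \<open>2 * e\<close> instead
    of \<open>e\<close>.\<close>
  obtain K where K: "consistent A K" "measure_pmf.prob (smear g p) K > ?w - 2 * e"
    using weight_least[of A "smear g p" "?w - 2 * e"] stable e(1) by fastforce
  have Z_le: "?Z K t \<le> ?w" if "t \<in> set_pmf p" for t
    using that pG g by (intro prob_translate_le_weight A K) auto
  let ?S = "\<Sum>t\<in>set_pmf p. pmf p t * ?Z K t"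
  have "?S \<le> ?w - 0 * ?P {}"
    using Z_le pG by (intro sum_pmf_le_minus_prob) auto
  moreover have "?P K / 2 + ?S / 2 > ?w - 2 * e"
    using K(2) by (simp add: prob_smear[OF p])
  \<comment> \<open>Both terms are at most \<open>?w\<close> and their mean exceeds
    \<open>?w - 2 * e\<close>.\<close>
  ultimately have PK: "?P K > ?w - 4 * e" and S: "?S > ?w - 4 * e"
    using weight_upper[OF K(1), of p] by auto
  \<comment> \<open>Otherwise all \<open>t\<close> in \<open>K\<close> stay \<open>d\<close> below
    \<open>?w\<close>, and the average \<open>?S\<close> loses at least
    \<open>d * (?w - 4 * e)\<close>, which is more than \<open>4 * e\<close>.\<close>
  have "\<exists>t\<in>set_pmf p. t \<in> K \<and> ?Z K t > c"
  proof (rule ccontr)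
    assume "\<not> ?thesis"
    then have "?S \<le> ?w - d * ?P K"
      using Z_le pG d by (intro sum_pmf_le_minus_prob) force+
    moreover have "d * ?P K \<ge> d * (?w - 4 * e)" using PK d by (intro mult_left_mono) auto
    ultimately show False using S e by linarith
  qed
  then obtain t where t: "t \<in> K" "t \<in> carrier G" "?Z K t > c" using pG by blast
  have "?Z K t \<le> ?P {b. b \<in> carrier G \<and> g \<otimes> b \<in> Delta G \<phi> I A}"
  proof (rule measure_pmf.finite_measure_mono_AE)
    show "AE b in measure_pmf p. b \<in> {b. t \<otimes> g \<otimes> b \<in> K} \<longrightarrow>
      b \<in> {b. b \<in> carrier G \<and> g \<otimes> b \<in> Delta G \<phi> I A}"
    proof (rule AE_pmfI, rule impI)
      fix b assume b: "b \<in> set_pmf p" "b \<in> {b. t \<otimes> g \<otimes> b \<in> K}"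
      then have c: "b \<in> carrier G" using pG by blast
      have "inv t \<otimes> (t \<otimes> g \<otimes> b) \<in> Delta G \<phi> I A"
        using consistent_Delta[OF A K(1) t(1)] b by blast
      moreover have "inv t \<otimes> (t \<otimes> g \<otimes> b) = g \<otimes> b"
        using t g c by (simp add: m_assoc) (simp flip: m_assoc)
      ultimately show "b \<in> {b. b \<in> carrier G \<and> g \<otimes> b \<in> Delta G \<phi> I A}" using c by simp
    qed
  qed auto
  with t(3) show ?thesis by linarith
qed

section \<open>Near-minimal total weight and the dichotomy\<close>

lemma partition_dichotomy:
  assumes n: "n \<ge> 1" and cover: "X = (\<Union>i\<in>{1..n}. A i)"
    and i0: "i0 \<in> {1..n}"
    and small: "\<not> (\<exists>F\<in>covers G (Delta G \<phi> I (A i0)). finite F \<and> card F < Suc n)"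
  shows "\<exists>i\<in>{1..n}. \<exists>F\<in>covers G (Delta G \<phi> I (A i) <#> Delta G \<phi> I (A i)). finite F \<and> card F < n"
proof -
  have AX: "A i \<subseteq> X" if "i \<in> {1..n}" for i using cover that by blast
  define M where "M = {p \<in> finite_distr G. weight (A i0) p \<le> 1 / real (Suc n)}"
  define s where "s p = (\<Sum>i\<in>{1..n}. weight (A i) p)" for p
  \<comment> \<open>This \<open>d\<close> solves \<open>1/(n+1) + (n-1)(1/n + d) = 1 - d\<close>, so
    some cell must reach \<open>1/n + d\<close>.\<close>
  define d where "d = 1 / (real n * real n * real (Suc n))"
  \<comment> \<open>Then \<open>4 * e\<close> is \<open>d / (4 * n)\<close>, while a weight of at
    least \<open>1/n + d\<close> still exceeds \<open>1 / (4 * n)\<close> after losing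
    \<open>4 * e\<close>.\<close>
  define e where "e = d / (16 * real n)"
  have n0: "real n \<ge> 1" using n by simp
  have d: "0 < d" "d \<le> 1"
  proof -
    have "real n * real n * real (Suc n) \<ge> 1 * 1 * 1" using n0 by (intro mult_mono) auto
    then show "0 < d" "d \<le> 1" unfolding d_def using n0 by (auto simp: divide_simps)
  qed
  have e: "e > 0" using d n0 by (simp add: e_def)
  obtain q where "q \<in> M"
    using uncovered_Delta_light[OF AX[OF i0] zero_less_Suc small] unfolding M_def by blast
  then have "s ` M \<noteq> {}" by blast
  moreover have bdd: "bdd_below (s ` M)"
    by (intro bdd_belowI[of _ 0]) (auto simp: s_def intro!: sum_nonneg weight_nonneg)
  ultimately obtain p where p: "p \<in> M" "s p < Inf (s ` M) + e"
    using cInf_lessD[of "s ` M" "Inf (s ` M) + e"] e by auto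
  have pf: "p \<in> finite_distr G" using p by (simp add: M_def)
  have "\<exists>i\<in>{1..n}. weight (A i) p \<ge> 1 / real n + d"
  proof (rule ccontr)
    assume neg: "\<not> ?thesis"
    have "s p = weight (A i0) p + (\<Sum>i\<in>{1..n}-{i0}. weight (A i) p)"
      unfolding s_def using i0 by (subst sum.remove[of _ i0]) auto
    also have "\<dots> \<le> 1 / real (Suc n) + (\<Sum>i\<in>{1..n}-{i0}. 1 / real n + d)"
      using p(1) neg by (intro add_mono sum_mono) (auto simp: M_def not_le less_imp_le)
    also have "\<dots> = 1 / real (Suc n) + (real n - 1) * (1 / real n + d)"
      using i0 n by (simp add: of_nat_diff)
    also have "\<dots> = 1 - d"
    proof -
      have "1 / (x + 1) + (x - 1) * (1 / x + 1 / (x * x * (x + 1))) = 1 - 1 / (x * x * (x + 1))"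
        if "x > 0" for x :: real
      proof -
        have "x \<noteq> 0" "x + 1 \<noteq> 0" using that by auto
        then show ?thesis by (simp add: divide_simps) (simp add: algebra_simps)
      qed
      from this[of "real n"] n0 show ?thesis by (simp add: d_def add.commute)
    qed
    finally show False
      using sum_weight_ge_1[OF cover _ pf] d unfolding s_def by simp
  qed
  then obtain i where i: "i \<in> {1..n}" "weight (A i) p \<ge> 1 / real n + d" by blast
  have "measure_pmf.prob p {b. b \<in> carrier G \<and> g \<otimes> b \<in> Delta G \<phi> I (A i)} > 1 / real n"
    if g: "g \<in> carrier G" for g
  proof (rule heavy_Delta[OF AX[OF i(1)] pf g])
    have le: "weight (A j) (smear g p) \<le> weight (A j) p" if "j \<in> {1..n}" for j
      using weight_smear_le[OF AX[OF that] pf g] .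
    \<comment> \<open>\<open>M\<close> is closed under smearing, so the total weight drops by at
      most \<open>e\<close>. As no other weight rises, that of \<open>A i\<close> alone drops by at
      most \<open>e\<close>.\<close>
    have "smear g p \<in> M" using p(1) le[OF i0] smear_finite_distr[OF pf g] by (simp add: M_def)
    then have "Inf (s ` M) \<le> s (smear g p)" using bdd by (intro cInf_lower) auto
    then have "s p - e \<le> s (smear g p)" using p(2) by linarith
    moreover have "s q = weight (A i) q + (\<Sum>j\<in>{1..n}-{i}. weight (A j) q)" for q
      unfolding s_def using i by (subst sum.remove[of _ i]) auto
    moreover have "(\<Sum>j\<in>{1..n}-{i}. weight (A j) (smear g p)) \<le> (\<Sum>j\<in>{1..n}-{i}. weight (A j) p)"
      using le by (intro sum_mono) auto
    ultimately show "weight (A i) p - e \<le> weight (A i) (smear g p)" by simp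
    have "4 * e = d * (1 / (4 * real n))" by (simp add: e_def)
    also have "\<dots> < d * (weight (A i) p - 4 * e)"
    proof (rule mult_strict_left_mono)
      have "4 * e \<le> 1 / (4 * real n)" using d n0 by (simp add: e_def divide_simps)
      moreover have "1 / (4 * real n) + 1 / (4 * real n) \<le> 1 / real n" using n0 by (simp add: field_simps)
      ultimately show "1 / (4 * real n) < weight (A i) p - 4 * e" using i(2) d by linarith
    qed (use d in auto)
    finally show "4 * e < d * (weight (A i) p - 4 * e)" .
  qed (use d e i in auto)
  then have "\<exists>F\<in>covers G (Delta G \<phi> I (A i) <#> Delta G \<phi> I (A i)). finite F \<and> card F < n"
    using n by (intro Delta_mult_covered[OF AX[OF i(1)], of n p]) auto
  then show ?thesis using i(1) by blast
qed

end

theorem corollary1: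
  fixes G :: "('g, 'm) monoid_scheme"
    and X :: "'x set"
    and \<phi> :: "'g \<Rightarrow> 'x \<Rightarrow> 'x"
    and I :: "'x set set"
    and A :: "nat \<Rightarrow> 'x set"
    and n :: nat
  assumes "ideal_G_space G X \<phi> I"
    and "n \<ge> 1"
    and "X = (\<Union>i\<in>{1..n}. A i)"
    and "disjoint_family_on A {1..n}"
  shows "(\<forall>i\<in>{1..n}. cov_le (cov G (Delta G \<phi> I (A i))) |{1..n}| ) \<or>
         (\<exists>i\<in>{1..n}. cov_less (cov G (Delta G \<phi> I (A i) <#>\<^bsub>G\<^esub> Delta G \<phi> I (A i))) |{1..n}| )"
proof -
  interpret ideal_G_space G X \<phi> I by fact
  have D: "Delta G \<phi> I B \<subseteq> carrier G" for B by (auto simp: Delta_def)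
  show ?thesis
    \<comment> \<open>A cell violating the first alternative serves as \<open>i0\<close>, with
      \<open>card F \<le> n\<close> read as \<open>card F < Suc n\<close>.\<close>
    unfolding cov_le_nat_iff[OF D] cov_less_nat_iff[OF set_mult_closed[OF D D]]
    using partition_dichotomy[OF assms(2,3)] by (meson less_Suc_eq_le)
qed

end
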